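(* Let $(X,d)$ be a complete convergence-symmetric metric space and $T:X\to X$ a contraction, i.e. there is $q\in[0,1)$ such that $d(T(x),T(y))\le q\,d(x,y)$ for all $x,y\in X$. Then $T$ has a unique fixed point $x^*$. Furthermore, for any $x_0\in X$, setting $x_n=T(x_{n-1})$ for $n\ge1$, one has $\lim_{n\to\infty}x_n=x^*$.
   Context: A metric on a non-empty set $X$ is a function $d:X\times X\to[0,\infty)$ with $d(x,y)=0$ iff $x=y$, and $d(x,z)\le d(x,y)+d(y,z)$ for all $x,y,z$; symmetry is NOT assumed. $(X,d)$ is convergence-symmetric if for any two sequences $(p_n),(q_n)$ in $X$, $d(p_n,q_n)\to0$ if and only if $d(q_n,p_n)\to0$. In such a space, $\lim x_n=x$ means $d(x_n,x)\to0$ (equivalently $d(x,x_n)\to 0$). A sequence $(x_n)$ is Cauchy if for every $\epsilon>0$ there is $N$ with $d(x_i,x_{i+k})<\epsilon$ for all $i\ge N$, $k\ge0$ (in a convergence-symmetric space this is equivalent to the same condition with $d(x_{i+k},x_i)$). The space is complete if every Cauchy sequence converges. *)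

theory Defs
  imports Complex_Main "HOL-Library.FuncSet"
begin

(* Metrics are not assumed symmetric, so the library's metric spaces do not apply.
   The space is a carrier set X; the values of d outside X are unconstrained. *)

definition asym_metric :: "'a set \<Rightarrow> ('a \<Rightarrow> 'a \<Rightarrow> real) \<Rightarrow> bool" where
  "asym_metric X d \<longleftrightarrow>
     X \<noteq> {} \<and>
     (\<forall>x\<in>X. \<forall>y\<in>X. 0 \<le> d x y) \<and>
     (\<forall>x\<in>X. \<forall>y\<in>X. d x y = 0 \<longleftrightarrow> x = y) \<and>
     (\<forall>x\<in>X. \<forall>y\<in>X. \<forall>z\<in>X. d x z \<le> d x y + d y z)"

definition convergence_symmetric :: "'a set \<Rightarrow> ('a \<Rightarrow> 'a \<Rightarrow> real) \<Rightarrow> bool" where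
  "convergence_symmetric X d \<longleftrightarrow>
     (\<forall>p q :: nat \<Rightarrow> 'a. range p \<subseteq> X \<longrightarrow> range q \<subseteq> X \<longrightarrow>
        ((\<lambda>n. d (p n) (q n)) \<longlonglongrightarrow> 0 \<longleftrightarrow> (\<lambda>n. d (q n) (p n)) \<longlonglongrightarrow> 0))"

(* The order of the arguments of d is immaterial in a convergence-symmetric space. *)
definition asym_converges :: "('a \<Rightarrow> 'a \<Rightarrow> real) \<Rightarrow> (nat \<Rightarrow> 'a) \<Rightarrow> 'a \<Rightarrow> bool" where
  "asym_converges d x l \<longleftrightarrow> (\<lambda>n. d (x n) l) \<longlonglongrightarrow> 0"

definition asym_Cauchy :: "('a \<Rightarrow> 'a \<Rightarrow> real) \<Rightarrow> (nat \<Rightarrow> 'a) \<Rightarrow> bool" where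
  "asym_Cauchy d x \<longleftrightarrow> (\<forall>\<epsilon>>0. \<exists>N. \<forall>i\<ge>N. \<forall>k. d (x i) (x (i + k)) < \<epsilon>)"

definition asym_complete :: "'a set \<Rightarrow> ('a \<Rightarrow> 'a \<Rightarrow> real) \<Rightarrow> bool" where
  "asym_complete X d \<longleftrightarrow>
     (\<forall>x. range x \<subseteq> X \<longrightarrow> asym_Cauchy d x \<longrightarrow> (\<exists>l\<in>X. asym_converges d x l))"

definition asym_contraction :: "'a set \<Rightarrow> ('a \<Rightarrow> 'a \<Rightarrow> real) \<Rightarrow> ('a \<Rightarrow> 'a) \<Rightarrow> bool" where
  "asym_contraction X d T \<longleftrightarrow>
     (\<exists>q. 0 \<le> q \<and> q < 1 \<and> (\<forall>x\<in>X. \<forall>y\<in>X. d (T x) (T y) \<le> q * d x y))"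

end

theory Submission
  imports Defs
begin

text \<open>
  Banach's argument, arranged so that symmetry enters only once. The distance from \<open>x\<close> forward to
  the points of its orbit stays below \<open>d x (T x) / (1 - q)\<close>, and applying \<open>T ^^ n\<close> shrinks it by
  \<open>q ^ n\<close>; this is the forward Cauchy condition, so the orbit has a limit \<open>l\<close>. The orbit also
  approaches \<open>T l\<close>, because \<open>T\<close> is a contraction. Here both \<open>d (T\<^sup>n x) l\<close> and
  \<open>d (T\<^sup>n x) (T l)\<close> tend to zero, which by itself does not identify the two limits, since the
  triangle inequality needs one of the distances reversed. Convergence symmetry permits exactly
  this reversal (lemma \<open>limit_unique\<close>), and so \<open>T l = l\<close>. An arbitrary orbit is compared with
  the fixed point by \<open>d (T\<^sup>n x) (T\<^sup>n l) \<le> q ^ n * d x l\<close>, and two fixed points by the case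
  \<open>n = 1\<close>.
\<close>

lemma funpow_mem:
  assumes "T \<in> X \<rightarrow> X" and "x \<in> X"
  shows "(T ^^ n) x \<in> X"
  using assms by (induction n) auto

lemma contraction_funpow:
  fixes d :: "'a \<Rightarrow> 'a \<Rightarrow> real"
  assumes "T \<in> X \<rightarrow> X" and "0 \<le> q"
    and contr: "\<And>x y. x \<in> X \<Longrightarrow> y \<in> X \<Longrightarrow> d (T x) (T y) \<le> q * d x y"
    and "x \<in> X" and "y \<in> X"
  shows "d ((T ^^ n) x) ((T ^^ n) y) \<le> q ^ n * d x y"
proof (induction n)
  case (Suc n)
  have "d ((T ^^ Suc n) x) ((T ^^ Suc n) y) \<le> q * d ((T ^^ n) x) ((T ^^ n) y)"
    using contr[OF funpow_mem funpow_mem] assms by simp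
  also have "\<dots> \<le> q * (q ^ n * d x y)"
    using Suc \<open>0 \<le> q\<close> by (rule mult_left_mono)
  finally show ?case by (simp add: mult.assoc)
qed simp

text \<open>
  The induction peels the first step off the orbit instead of the last: the bound \<open>B\<close> satisfies
  \<open>B = d x (T x) + q * B\<close>, so no geometric series has to be summed.
\<close>

lemma orbit_bounded:
  assumes "asym_metric X d" and "T \<in> X \<rightarrow> X" and "0 \<le> q" and "q < 1"
    and contr: "\<And>x y. x \<in> X \<Longrightarrow> y \<in> X \<Longrightarrow> d (T x) (T y) \<le> q * d x y"
    and "x \<in> X"
  shows "d x ((T ^^ k) x) \<le> d x (T x) / (1 - q)"
proof (induction k)
  case 0
  have "T x \<in> X" using assms by auto
  then have "d x x = 0" and "0 \<le> d x (T x)"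
    using assms(1) \<open>x \<in> X\<close> unfolding asym_metric_def by blast+
  then show ?case
    using \<open>q < 1\<close> by simp
next
  case (Suc k)
  have mem: "T x \<in> X" "(T ^^ k) x \<in> X" "T ((T ^^ k) x) \<in> X"
    using assms funpow_mem[of T X x k] by auto
  have "d x ((T ^^ Suc k) x) \<le> d x (T x) + d (T x) (T ((T ^^ k) x))"
    using assms mem unfolding asym_metric_def by simp
  also have "\<dots> \<le> d x (T x) + q * d x ((T ^^ k) x)"
    using contr \<open>x \<in> X\<close> mem by simp
  also have "\<dots> \<le> d x (T x) + q * (d x (T x) / (1 - q))"
    using Suc \<open>0 \<le> q\<close> by (intro add_left_mono mult_left_mono)
  also have "\<dots> = d x (T x) / (1 - q)"
    using \<open>q < 1\<close> by (simp add: field_simps)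
  finally show ?case .
qed

lemma orbit_Cauchy:
  assumes "asym_metric X d" and "T \<in> X \<rightarrow> X" and "0 \<le> q" and "q < 1"
    and contr: "\<And>x y. x \<in> X \<Longrightarrow> y \<in> X \<Longrightarrow> d (T x) (T y) \<le> q * d x y"
    and "x \<in> X"
  shows "asym_Cauchy d (\<lambda>n. (T ^^ n) x)"
  unfolding asym_Cauchy_def
proof (intro allI impI)
  fix \<epsilon> :: real assume "0 < \<epsilon>"
  define B where "B = d x (T x) / (1 - q)"
  have bound: "d ((T ^^ i) x) ((T ^^ (i + k)) x) \<le> q ^ i * B" for i k
  proof -
    have "d ((T ^^ i) x) ((T ^^ (i + k)) x) \<le> q ^ i * d x ((T ^^ k) x)"
      using contraction_funpow[of T X q d x "(T ^^ k) x" i] assms funpow_mem[of T X x k]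
      by (simp add: funpow_add)
    also have "\<dots> \<le> q ^ i * B"
      unfolding B_def using orbit_bounded[of X d T q x k] assms by (intro mult_left_mono) auto
    finally show ?thesis .
  qed
  have "(\<lambda>i. q ^ i * B) \<longlonglongrightarrow> 0"
    using \<open>0 \<le> q\<close> \<open>q < 1\<close> by (intro tendsto_mult_left_zero LIMSEQ_realpow_zero)
  then have "eventually (\<lambda>i. q ^ i * B < \<epsilon>) sequentially"
    using \<open>0 < \<epsilon>\<close> by (rule order_tendstoD)
  then obtain N where "\<forall>i\<ge>N. q ^ i * B < \<epsilon>"
    by (auto simp: eventually_sequentially)
  then show "\<exists>N. \<forall>i\<ge>N. \<forall>k. d ((T ^^ i) x) ((T ^^ (i + k)) x) < \<epsilon>"
    using bound by (meson le_less_trans)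
qed

text \<open>
  Convergence symmetry, applied to the sequence \<open>x\<close> and a constant sequence, turns
  \<open>d (x n) m\<close> into \<open>d m (x n)\<close>; then \<open>d m l \<le> d m (x n) + d (x n) l\<close> gives \<open>m = l\<close>.
\<close>

lemma limit_unique:
  assumes metric: "asym_metric X d" and sym: "convergence_symmetric X d"
    and x: "range x \<subseteq> X" and "l \<in> X" and "m \<in> X"
    and "asym_converges d x l" and "asym_converges d x m"
  shows "m = l"
proof -
  have "range (\<lambda>n::nat. m) \<subseteq> X" using \<open>m \<in> X\<close> by auto
  then have "(\<lambda>n. d m (x n)) \<longlonglongrightarrow> 0"
    using sym x \<open>asym_converges d x m\<close>
    unfolding convergence_symmetric_def asym_converges_def by blast
  then have lim: "(\<lambda>n. d m (x n) + d (x n) l) \<longlonglongrightarrow> 0"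
    using \<open>asym_converges d x l\<close> unfolding asym_converges_def by (rule tendsto_add_zero)
  have "d m l \<le> d m (x n) + d (x n) l" for n
    using metric x \<open>l \<in> X\<close> \<open>m \<in> X\<close> unfolding asym_metric_def by (simp add: range_subsetD)
  then have "d m l \<le> 0"
    using lim by (intro LIMSEQ_le_const[OF lim]) auto
  moreover have "0 \<le> d m l" and "d m l = 0 \<longleftrightarrow> m = l"
    using metric \<open>l \<in> X\<close> \<open>m \<in> X\<close> unfolding asym_metric_def by blast+
  ultimately show ?thesis by simp
qed

lemma orbit_converges_to_fixed_point:
  assumes "asym_metric X d" and "T \<in> X \<rightarrow> X" and "0 \<le> q" and "q < 1"
    and contr: "\<And>x y. x \<in> X \<Longrightarrow> y \<in> X \<Longrightarrow> d (T x) (T y) \<le> q * d x y"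
    and "x \<in> X" and "l \<in> X" and "T l = l"
  shows "asym_converges d (\<lambda>n. (T ^^ n) x) l"
  unfolding asym_converges_def
proof (rule tendsto_sandwich[OF _ _ tendsto_const])
  have "(T ^^ n) l = l" for n
    using \<open>T l = l\<close> by (induction n) auto
  then have "d ((T ^^ n) x) l \<le> q ^ n * d x l" for n
    using contraction_funpow[of T X q d x l n] assms by simp
  then show "\<forall>\<^sub>F n in sequentially. d ((T ^^ n) x) l \<le> q ^ n * d x l"
    by simp
  show "\<forall>\<^sub>F n in sequentially. 0 \<le> d ((T ^^ n) x) l"
    using assms funpow_mem[of T X x] unfolding asym_metric_def by simp
  show "(\<lambda>n. q ^ n * d x l) \<longlonglongrightarrow> 0"
    using \<open>0 \<le> q\<close> \<open>q < 1\<close> by (intro tendsto_mult_left_zero LIMSEQ_realpow_zero)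
qed

lemma orbit_limit_is_fixed_point:
  assumes metric: "asym_metric X d" and sym: "convergence_symmetric X d"
    and T: "T \<in> X \<rightarrow> X"
    and contr: "\<And>x y. x \<in> X \<Longrightarrow> y \<in> X \<Longrightarrow> d (T x) (T y) \<le> q * d x y"
    and "x \<in> X" and "l \<in> X" and conv: "asym_converges d (\<lambda>n. (T ^^ n) x) l"
  shows "T l = l"
proof -
  have mem: "(T ^^ n) x \<in> X" for n
    using T \<open>x \<in> X\<close> by (rule funpow_mem)
  have "T l \<in> X" using T \<open>l \<in> X\<close> by auto
  \<comment> \<open>The common sequence tending to both \<open>l\<close> and \<open>T l\<close> is the orbit without its first point.\<close>
  have to_l: "asym_converges d (\<lambda>n. (T ^^ Suc n) x) l"
    using conv unfolding asym_converges_def by (rule LIMSEQ_Suc)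
  have to_Tl: "asym_converges d (\<lambda>n. (T ^^ Suc n) x) (T l)"
    unfolding asym_converges_def
  proof (rule tendsto_sandwich[OF _ _ tendsto_const])
    show "\<forall>\<^sub>F n in sequentially. 0 \<le> d ((T ^^ Suc n) x) (T l)"
      using metric mem[of "Suc _"] \<open>T l \<in> X\<close> unfolding asym_metric_def
      by (intro always_eventually allI) blast
    show "\<forall>\<^sub>F n in sequentially. d ((T ^^ Suc n) x) (T l) \<le> q * d ((T ^^ n) x) l"
      using contr mem \<open>l \<in> X\<close> by simp
    show "(\<lambda>n. q * d ((T ^^ n) x) l) \<longlonglongrightarrow> 0"
      using conv unfolding asym_converges_def by (rule tendsto_mult_right_zero)
  qed
  have "range (\<lambda>n. (T ^^ Suc n) x) \<subseteq> X" using mem by blast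
  then show ?thesis
    using limit_unique[OF metric sym] to_l to_Tl \<open>l \<in> X\<close> \<open>T l \<in> X\<close> by blast
qed

lemma fixed_point_unique:
  assumes "asym_metric X d" and "q < 1"
    and contr: "\<And>x y. x \<in> X \<Longrightarrow> y \<in> X \<Longrightarrow> d (T x) (T y) \<le> q * d x y"
    and "x \<in> X" "T x = x" "y \<in> X" "T y = y"
  shows "x = y"
proof -
  have "(1 - q) * d x y \<le> 0"
    using contr[of x y] assms by (simp add: algebra_simps)
  then have "d x y \<le> 0"
    using \<open>q < 1\<close> by (simp add: mult_le_0_iff)
  moreover have "0 \<le> d x y" and "d x y = 0 \<longleftrightarrow> x = y"
    using assms unfolding asym_metric_def by blast+
  ultimately show ?thesis by simp
qed

theorem theorem4p34:
  fixes X :: "'a set" and d :: "'a \<Rightarrow> 'a \<Rightarrow> real" and T :: "'a \<Rightarrow> 'a"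
  assumes "asym_metric X d"
    and "convergence_symmetric X d"
    and "asym_complete X d"
    and "T \<in> X \<rightarrow> X"
    and "asym_contraction X d T"
  shows "\<exists>xs\<in>X. T xs = xs \<and> (\<forall>y\<in>X. T y = y \<longrightarrow> y = xs) \<and>
           (\<forall>x :: nat \<Rightarrow> 'a. x 0 \<in> X \<longrightarrow> (\<forall>n\<ge>1. x n = T (x (n - 1))) \<longrightarrow>
              asym_converges d x xs)"
proof -
  obtain q where q: "0 \<le> q" "q < 1"
    and contr: "\<And>x y. x \<in> X \<Longrightarrow> y \<in> X \<Longrightarrow> d (T x) (T y) \<le> q * d x y"
    using assms unfolding asym_contraction_def by blast
  obtain a where "a \<in> X"
    using assms unfolding asym_metric_def by blast
  have "range (\<lambda>n. (T ^^ n) a) \<subseteq> X"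
    using funpow_mem[OF \<open>T \<in> X \<rightarrow> X\<close> \<open>a \<in> X\<close>] by blast
  then obtain l where l: "l \<in> X" and conv: "asym_converges d (\<lambda>n. (T ^^ n) a) l"
    using orbit_Cauchy[OF assms(1,4) q contr \<open>a \<in> X\<close>] assms(3)
    unfolding asym_complete_def by blast
  have fixed: "T l = l"
    using orbit_limit_is_fixed_point[OF assms(1,2,4) contr \<open>a \<in> X\<close> l conv] .
  have unique: "y = l" if "y \<in> X" "T y = y" for y
    using fixed_point_unique[OF assms(1) q(2) contr that l fixed] .
  have attracts: "asym_converges d x l"
    if "x 0 \<in> X" and step: "\<forall>n\<ge>1. x n = T (x (n - 1))" for x :: "nat \<Rightarrow> 'a"
  proof -
    have "x n = (T ^^ n) (x 0)" for n
      using step by (induction n) auto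
    then have "x = (\<lambda>n. (T ^^ n) (x 0))" by blast
    then show ?thesis
      using orbit_converges_to_fixed_point[OF assms(1,4) q contr \<open>x 0 \<in> X\<close> l fixed] by simp
  qed
  show ?thesis
    using l fixed unique attracts by blast
qed

end
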